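(* Let $(L,\delta,\alpha)$ and $(V,\mu,\alpha_V)$ be left Hom-Leibniz algebras, and let $\lambda_l\colon L\times V\to V$, $\lambda_r\colon V\times L\to V$, $\theta\colon L\times L\to V$ be bilinear maps. The triple $(\lambda_r,\lambda_l,\theta)$ is a $2$-cocycle of the left Hom-Leibniz algebra $L$ with values in $V$ if and only if, for all $x,y,z\in L$ and $v,w\in V$: 1. $\lambda_r(\alpha_V(v),\alpha(x))=\alpha_V(\lambda_r(v,x))$; 2. $\lambda_l(\alpha(x),\alpha_V(v))=\alpha_V(\lambda_l(x,v))$; 3. $\lambda_l(\alpha(x),\lambda_l(y,v))=\lambda_l(\delta(x,y),\alpha_V(v))+\lambda_l(\alpha(y),\lambda_l(x,v))+\mu(\theta(x,y),\alpha_V(v))$; 4. $\lambda_l(\alpha(x),\lambda_r(v,y))=\lambda_r(\lambda_l(x,v),\alpha(y))+\lambda_r(\alpha_V(v),\delta(x,y))+\mu(\alpha_V(v),\theta(x,y))$; 5. $\lambda_r(\alpha_V(v),\delta(x,y))=\lambda_r(\lambda_r(v,x),\alpha(y))+\lambda_l(\alpha(x),\lambda_r(v,y))-\mu(\alpha_V(v),\theta(x,y))$; 6. $\lambda_l(\alpha(x),\mu(v,w))=\mu(\alpha_V(v),\lambda_l(x,w))+\mu(\lambda_l(x,v),\alpha_V(w))$; 7. $\mu(\alpha_V(v),\lambda_l(x,w))=\mu(\lambda_r(v,x),\alpha_V(w))+\lambda_l(\alpha(x),\mu(v,w))$; 8. $\mu(\alpha_V(v),\lambda_r(w,x))=\mu(\alpha_V(w),\lambda_r(v,x))+\lambda_r(\mu(v,w),\alpha(x))$;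 9. $\theta(\alpha(x),\alpha(y))=\alpha_V(\theta(x,y))$; 10. $\theta(\delta(x,y),\alpha(z))+\theta(\alpha(y),\delta(x,z))-\theta(\alpha(x),\delta(y,z))+\lambda_r(\theta(x,y),\alpha(z))+\lambda_l(\alpha(y),\theta(x,z))-\lambda_l(\alpha(x),\theta(y,z))=0$.
   Context: The base field $\mathbb K$ has characteristic zero. A left Hom-Leibniz algebra is a triple $(M,d,\beta)$ with $M$ a vector space, $d$ bilinear, $\beta$ linear, $d(\beta(a),d(b,c))=d(d(a,b),\beta(c))+d(\beta(b),d(a,c))$, assumed multiplicative: $\beta(d(a,b))=d(\beta(a),\beta(b))$. For bilinear $f,g$ on $M$ put $(f\circ_l g)(a,b,c)=f(g(a,b),\beta(c))+f(\beta(b),g(a,c))-f(\beta(a),g(b,c))$ and $[f,g]=f\circ_l g+g\circ_l f$ (the left $\beta$-Nijenhuis--Richardson bracket). Put $M=L\oplus V$, $\beta=\alpha\oplus\alpha_V$. The maps $\delta\colon L\times L\to L$, $\mu\colon V\times V\to V$, $\lambda_l$, $\lambda_r$, $\theta$ are viewed as bilinear maps on $M$ by extending them by zero on the other components. The triple $(\lambda_l,\lambda_r,\theta)$ is a $2$-cocycle of $L$ with values in $V$ if $2[\delta,\lambda_r+\lambda_l]+[\lambda_r+\lambda_l,\lambda_r+\lambda_l]+2[\mu,\theta]=0$, $[\mu,\lambda_r+\lambda_l]=0$, $[\delta+\lambda_r+\lambda_l,\theta]=0$, $\lambda_r\circ(\alpha_V\otimes\alpha)=\alpha_V\circ\lambda_r$,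 $\lambda_l\circ(\alpha\otimes\alpha_V)=\alpha_V\circ\lambda_l$, $\theta\circ(\alpha\otimes\alpha)=\alpha_V\circ\theta$. *)

theory Defs
  imports "HOL-Analysis.Product_Vector" "HOL-Library.Function_Algebras"
begin

text \<open>Vector spaces are given by their scalar multiplication in the sense of
  \<^locale>\<open>vector_space\<close>, with the whole type as carrier; the direct sum \<open>L \<oplus> V\<close> is
  the product type with the scalar multiplication \<^const>\<open>module_prod.scale\<close>.
  Sums of bilinear maps are pointwise sums (\<^theory>\<open>HOL-Library.Function_Algebras\<close>).\<close>

definition bilinear_map ::
  "('k::field \<Rightarrow> 'a::ab_group_add \<Rightarrow> 'a) \<Rightarrow> ('k \<Rightarrow> 'b::ab_group_add \<Rightarrow> 'b) \<Rightarrow>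
   ('k \<Rightarrow> 'c::ab_group_add \<Rightarrow> 'c) \<Rightarrow> ('a \<Rightarrow> 'b \<Rightarrow> 'c) \<Rightarrow> bool"
where
  "bilinear_map s1 s2 s3 f \<longleftrightarrow>
     (\<forall>a. Vector_Spaces.linear s2 s3 (f a)) \<and> (\<forall>b. Vector_Spaces.linear s1 s3 (\<lambda>a. f a b))"

locale left_hom_leibniz =
  vector_space scale
  for scale :: "'k::field_char_0 \<Rightarrow> 'm::ab_group_add \<Rightarrow> 'm" +
  fixes d :: "'m \<Rightarrow> 'm \<Rightarrow> 'm"
    and \<beta> :: "'m \<Rightarrow> 'm"
  assumes bilinear_d: "bilinear_map scale scale scale d"
    and linear_twist: "Vector_Spaces.linear scale scale \<beta>"
    and hom_leibniz: "d (\<beta> a) (d b c) = d (d a b) (\<beta> c) + d (\<beta> b) (d a c)"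
    and multiplicative: "\<beta> (d a b) = d (\<beta> a) (\<beta> b)"

definition circ_l ::
  "('m::ab_group_add \<Rightarrow> 'm) \<Rightarrow> ('m \<Rightarrow> 'm \<Rightarrow> 'm) \<Rightarrow> ('m \<Rightarrow> 'm \<Rightarrow> 'm) \<Rightarrow> 'm \<Rightarrow> 'm \<Rightarrow> 'm \<Rightarrow> 'm"
where
  "circ_l \<beta> f g a b c = f (g a b) (\<beta> c) + f (\<beta> b) (g a c) - f (\<beta> a) (g b c)"

text \<open>The left \<open>\<beta>\<close>-Nijenhuis--Richardson bracket of two bilinear maps.\<close>

definition nr_bracket ::
  "('m::ab_group_add \<Rightarrow> 'm) \<Rightarrow> ('m \<Rightarrow> 'm \<Rightarrow> 'm) \<Rightarrow> ('m \<Rightarrow> 'm \<Rightarrow> 'm) \<Rightarrow> 'm \<Rightarrow> 'm \<Rightarrow> 'm \<Rightarrow> 'm"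
where
  "nr_bracket \<beta> f g = circ_l \<beta> f g + circ_l \<beta> g f"

text \<open>Extension by zero to \<open>L \<oplus> V\<close>; the suffix names the two argument components and the
  component of the value.\<close>

definition ext_LLL :: "('l \<Rightarrow> 'l \<Rightarrow> 'l) \<Rightarrow> 'l \<times> 'v \<Rightarrow> 'l \<times> 'v \<Rightarrow> 'l \<times> 'v::zero" where
  "ext_LLL f a b = (f (fst a) (fst b), 0)"

definition ext_VVV :: "('v \<Rightarrow> 'v \<Rightarrow> 'v) \<Rightarrow> 'l \<times> 'v \<Rightarrow> 'l \<times> 'v \<Rightarrow> 'l::zero \<times> 'v" where
  "ext_VVV f a b = (0, f (snd a) (snd b))"

definition ext_LVV :: "('l \<Rightarrow> 'v \<Rightarrow> 'v) \<Rightarrow> 'l \<times> 'v \<Rightarrow> 'l \<times> 'v \<Rightarrow> 'l::zero \<times> 'v" where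
  "ext_LVV f a b = (0, f (fst a) (snd b))"

definition ext_VLV :: "('v \<Rightarrow> 'l \<Rightarrow> 'v) \<Rightarrow> 'l \<times> 'v \<Rightarrow> 'l \<times> 'v \<Rightarrow> 'l::zero \<times> 'v" where
  "ext_VLV f a b = (0, f (snd a) (fst b))"

definition ext_LLV :: "('l \<Rightarrow> 'l \<Rightarrow> 'v) \<Rightarrow> 'l \<times> 'v \<Rightarrow> 'l \<times> 'v \<Rightarrow> 'l::zero \<times> 'v" where
  "ext_LLV f a b = (0, f (fst a) (fst b))"

text \<open>The arguments are the data of \<open>L\<close>, the data of \<open>V\<close>, and the triple
  \<open>(lam_r, lam_l, \<theta>)\<close>, whose members are meant to be bilinear.\<close>

definition is_2cocycle ::
  "('k::field_char_0 \<Rightarrow> 'l::ab_group_add \<Rightarrow> 'l) \<Rightarrow> ('l \<Rightarrow> 'l \<Rightarrow> 'l) \<Rightarrow> ('l \<Rightarrow> 'l) \<Rightarrow>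
   ('k \<Rightarrow> 'v::ab_group_add \<Rightarrow> 'v) \<Rightarrow> ('v \<Rightarrow> 'v \<Rightarrow> 'v) \<Rightarrow> ('v \<Rightarrow> 'v) \<Rightarrow>
   ('v \<Rightarrow> 'l \<Rightarrow> 'v) \<Rightarrow> ('l \<Rightarrow> 'v \<Rightarrow> 'v) \<Rightarrow> ('l \<Rightarrow> 'l \<Rightarrow> 'v) \<Rightarrow> bool"
where
  "is_2cocycle sL \<delta> \<alpha> sV \<mu> \<alpha>V lam_r lam_l \<theta> \<longleftrightarrow>
    (let sM = module_prod.scale sL sV;
         \<beta> = map_prod \<alpha> \<alpha>V;
         D = ext_LLL \<delta>;
         U = ext_VVV \<mu>;
         R = ext_VLV lam_r + ext_LVV lam_l;
         T = ext_LLV \<theta>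
     in (\<forall>a b c. sM 2 (nr_bracket \<beta> D R a b c) + nr_bracket \<beta> R R a b c
                 + sM 2 (nr_bracket \<beta> U T a b c) = 0) \<and>
        nr_bracket \<beta> U R = 0 \<and>
        nr_bracket \<beta> (D + R) T = 0 \<and>
        (\<forall>v x. lam_r (\<alpha>V v) (\<alpha> x) = \<alpha>V (lam_r v x)) \<and>
        (\<forall>x v. lam_l (\<alpha> x) (\<alpha>V v) = \<alpha>V (lam_l x v)) \<and>
        (\<forall>x y. \<theta> (\<alpha> x) (\<alpha> y) = \<alpha>V (\<theta> x y)))"

end

theory Submission
  imports Defs
begin

text \<open>The left-hand side of each bracket equation takes its values in \<open>V\<close> and is trilinear in
  three arguments from \<open>L \<oplus> V\<close>. Expanded by additivity, each of its terms depends on a single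
  component, \<open>L\<close> or \<open>V\<close>, of each argument; call this choice the type of the term. The types of
  the first equation have two arguments in \<open>L\<close> and one in \<open>V\<close>, those of the second have one
  argument in \<open>L\<close> and two in \<open>V\<close>, and the third equation has all three in \<open>L\<close>. Trilinear
  functions of pairwise different types have sum zero iff each of them is zero, because setting
  the other components to \<open>0\<close> isolates any one of them. So the first two equations split into
  three identities each, one for each position of the odd argument: the first gives the
  identities in \<open>x\<close>, \<open>y\<close> and \<open>v\<close> that involve \<open>\<delta>\<close>, and the second those in \<open>x\<close>, \<open>v\<close> and \<open>w\<close>.
  The third equation is the identity in \<open>x\<close>, \<open>y\<close>, \<open>z\<close>, and the compatibility with the
  twists is the same on both sides.

  The content is therefore in the three evaluations \<open>half_first_equation\<close>,
  \<open>bracket_product_action\<close> and \<open>bracket_cochain\<close>. The factors \<open>2\<close> in the first equation match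
  \<open>[R, R] = 2 (R \<circ>\<^sub>l R)\<close>, and characteristic zero lets one divide by them.\<close>

lemma bilinear_map_add:
  assumes "bilinear_map s1 s2 s3 f"
  shows "f (a + a') b = f a b + f a' b" and "f a (b + b') = f a b + f a b'"
  using assms unfolding bilinear_map_def Vector_Spaces.linear_iff by simp_all

lemma linear_map_zero: "Vector_Spaces.linear s1 s2 f \<Longrightarrow> f 0 = 0"
  unfolding Vector_Spaces.linear_iff by (metis add_cancel_right_right)

lemma bilinear_map_zero:
  assumes "bilinear_map s1 s2 s3 f"
  shows "f 0 b = 0" and "f a 0 = 0"
  using assms linear_map_zero unfolding bilinear_map_def by (blast, blast)

locale extension_data =
  L: left_hom_leibniz sL \<delta> \<alpha> + V: left_hom_leibniz sV \<mu> \<alpha>V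
  for sL :: "'k::field_char_0 \<Rightarrow> 'l::ab_group_add \<Rightarrow> 'l"
    and \<delta> :: "'l \<Rightarrow> 'l \<Rightarrow> 'l"
    and \<alpha> :: "'l \<Rightarrow> 'l"
    and sV :: "'k \<Rightarrow> 'v::ab_group_add \<Rightarrow> 'v"
    and \<mu> :: "'v \<Rightarrow> 'v \<Rightarrow> 'v"
    and \<alpha>V :: "'v \<Rightarrow> 'v" +
  fixes lam_l :: "'l \<Rightarrow> 'v \<Rightarrow> 'v"
    and lam_r :: "'v \<Rightarrow> 'l \<Rightarrow> 'v"
    and \<theta> :: "'l \<Rightarrow> 'l \<Rightarrow> 'v"
  assumes bilinear_l: "bilinear_map sL sV sV lam_l"
    and bilinear_r: "bilinear_map sV sL sV lam_r"
    and bilinear_cochain: "bilinear_map sL sL sV \<theta>"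
begin

abbreviation "twist \<equiv> map_prod \<alpha> \<alpha>V"
abbreviation "D \<equiv> ext_LLL \<delta> :: 'l \<times> 'v \<Rightarrow> 'l \<times> 'v \<Rightarrow> 'l \<times> 'v"
abbreviation "U \<equiv> ext_VVV \<mu> :: 'l \<times> 'v \<Rightarrow> 'l \<times> 'v \<Rightarrow> 'l \<times> 'v"
abbreviation "R \<equiv> ext_VLV lam_r + ext_LVV lam_l :: 'l \<times> 'v \<Rightarrow> 'l \<times> 'v \<Rightarrow> 'l \<times> 'v"
abbreviation "T \<equiv> ext_LLV \<theta> :: 'l \<times> 'v \<Rightarrow> 'l \<times> 'v \<Rightarrow> 'l \<times> 'v"

lemmas map_zeros =
  bilinear_map_zero[OF L.bilinear_d] bilinear_map_zero[OF V.bilinear_d]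
  bilinear_map_zero[OF bilinear_l] bilinear_map_zero[OF bilinear_r]
  bilinear_map_zero[OF bilinear_cochain]
  linear_map_zero[OF L.linear_twist] linear_map_zero[OF V.linear_twist]

lemmas map_adds =
  bilinear_map_add[OF V.bilinear_d] bilinear_map_add[OF bilinear_l] bilinear_map_add[OF bilinear_r]

lemmas ext_eval = ext_LLL_def ext_VVV_def ext_LVV_def ext_VLV_def ext_LLV_def

text \<open>The parts of the first two bracket equations, indexed by their types. The first three
  measure how far \<open>lam_l\<close> and \<open>lam_r\<close> are from a representation of \<open>L\<close>, with a curvature
  correction \<open>\<theta>\<close> that acts through \<open>\<mu>\<close>; the last three measure the failure of \<open>\<mu>\<close> to be
  compatible with these actions.\<close>

definition "defect_LLV x y v =
  lam_l (\<delta> x y) (\<alpha>V v) + lam_l (\<alpha> y) (lam_l x v) + \<mu> (\<theta> x y) (\<alpha>V v) - lam_l (\<alpha> x) (lam_l y v)"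

definition "defect_LVL x v y =
  lam_r (lam_l x v) (\<alpha> y) + lam_r (\<alpha>V v) (\<delta> x y) + \<mu> (\<alpha>V v) (\<theta> x y) - lam_l (\<alpha> x) (lam_r v y)"

definition "defect_VLL v x y =
  lam_r (lam_r v x) (\<alpha> y) + lam_l (\<alpha> x) (lam_r v y) - \<mu> (\<alpha>V v) (\<theta> x y) - lam_r (\<alpha>V v) (\<delta> x y)"

definition "defect_LVV x v w =
  \<mu> (\<alpha>V v) (lam_l x w) + \<mu> (lam_l x v) (\<alpha>V w) - lam_l (\<alpha> x) (\<mu> v w)"

definition "defect_VLV v x w =
  \<mu> (lam_r v x) (\<alpha>V w) + lam_l (\<alpha> x) (\<mu> v w) - \<mu> (\<alpha>V v) (lam_l x w)"

definition "defect_VVL v w x =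
  \<mu> (\<alpha>V w) (lam_r v x) + lam_r (\<mu> v w) (\<alpha> x) - \<mu> (\<alpha>V v) (lam_r w x)"

lemmas defect_defs = defect_LLV_def defect_LVL_def defect_VLL_def
  defect_LVV_def defect_VLV_def defect_VVL_def

text \<open>This is half of the left-hand side of the first equation; dividing first avoids carrying the
  coefficient \<open>2\<close> through the expansion. The compositions
  \<open>\<delta> \<circ>\<^sub>l (lam_r + lam_l)\<close> and \<open>\<theta> \<circ>\<^sub>l \<mu>\<close> vanish, as the inner map has values in \<open>V\<close> and the
  outer one reads only \<open>L\<close>.\<close>

lemma half_first_equation:
  "nr_bracket twist D R (x1, v1) (x2, v2) (x3, v3) + circ_l twist R R (x1, v1) (x2, v2) (x3, v3)
     + nr_bracket twist U T (x1, v1) (x2, v2) (x3, v3)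
   = (0, defect_LLV x1 x2 v3 + defect_LVL x1 v2 x3 + defect_VLL v1 x2 x3)"
  by (simp add: nr_bracket_def circ_l_def ext_eval defect_defs map_zeros map_adds algebra_simps)

lemma bracket_product_action:
  "nr_bracket twist U R (x1, v1) (x2, v2) (x3, v3)
   = (0, defect_LVV x1 v2 v3 + defect_VLV v1 x2 v3 + defect_VVL v1 v2 x3)"
  by (simp add: nr_bracket_def circ_l_def ext_eval defect_defs map_zeros map_adds algebra_simps)

lemma bracket_cochain:
  "nr_bracket twist (D + R) T (x, u) (y, v) (z, w)
   = (0, \<theta> (\<delta> x y) (\<alpha> z) + \<theta> (\<alpha> y) (\<delta> x z) - \<theta> (\<alpha> x) (\<delta> y z)
        + lam_r (\<theta> x y) (\<alpha> z) + lam_l (\<alpha> y) (\<theta> x z) - lam_l (\<alpha> x) (\<theta> y z))"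
  by (simp add: nr_bracket_def circ_l_def ext_eval map_zeros algebra_simps)

lemma defect_zeros:
  "defect_LLV 0 y v = 0" "defect_LLV x y 0 = 0"
  "defect_LVL 0 v y = 0" "defect_LVL x 0 y = 0"
  "defect_VLL 0 x y = 0" "defect_VLL v x 0 = 0"
  "defect_LVV 0 v w = 0" "defect_LVV x v 0 = 0"
  "defect_VLV 0 x w = 0" "defect_VLV v 0 w = 0"
  "defect_VVL 0 w x = 0" "defect_VVL v w 0 = 0"
  by (simp_all add: defect_defs map_zeros)

text \<open>At arguments that have only one nonzero component each, of types that match one of the
  summands, the other two summands have a zero argument.\<close>

lemma first_equation_split:
  "(\<forall>x1 v1 x2 v2 x3 v3. defect_LLV x1 x2 v3 + defect_LVL x1 v2 x3 + defect_VLL v1 x2 x3 = 0) \<longleftrightarrow>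
   (\<forall>x y v. defect_LLV x y v = 0 \<and> defect_LVL x v y = 0 \<and> defect_VLL v x y = 0)"
  (is "?sum \<longleftrightarrow> ?parts")
proof
  assume sum: ?sum
  show ?parts
  proof (intro allI conjI)
    fix x y v
    show "defect_LLV x y v = 0"
      using sum[rule_format, of x y v 0 0 0] by (simp add: defect_zeros)
    show "defect_LVL x v y = 0"
      using sum[rule_format, of x 0 0 v y 0] by (simp add: defect_zeros)
    show "defect_VLL v x y = 0"
      using sum[rule_format, of 0 x 0 0 y v] by (simp add: defect_zeros)
  qed
qed simp

lemma second_equation_split:
  "(\<forall>x1 v1 x2 v2 x3 v3. defect_LVV x1 v2 v3 + defect_VLV v1 x2 v3 + defect_VVL v1 v2 x3 = 0) \<longleftrightarrow>
   (\<forall>x v w. defect_LVV x v w = 0 \<and> defect_VLV v x w = 0 \<and> defect_VVL v w x = 0)"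
  (is "?sum \<longleftrightarrow> ?parts")
proof
  assume sum: ?sum
  show ?parts
  proof (intro allI conjI)
    fix x v w
    show "defect_LVV x v w = 0"
      using sum[rule_format, of x v w 0 0 0] by (simp add: defect_zeros)
    show "defect_VLV v x w = 0"
      using sum[rule_format, of 0 0 w v x 0] by (simp add: defect_zeros)
    show "defect_VVL v w x = 0"
      using sum[rule_format, of 0 w 0 v 0 x] by (simp add: defect_zeros)
  qed
qed simp

lemma double_eq_zero_iff: "v + v = 0 \<longleftrightarrow> v = 0" for v :: 'v
  using V.scale_left_distrib[of 1 1 v] V.scale_eq_0_iff[of 2 v] by simp

lemma scale_two: "module_prod.scale sL sV 2 a = a + a"
  using L.scale_left_distrib[of 1 1 "fst a"] V.scale_left_distrib[of 1 1 "snd a"]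
  by (simp add: module_prod.scale_def[OF
        module_prod.intro[OF module_pair.intro[OF L.module_axioms V.module_axioms]]]
      case_prod_beta plus_prod_def)

lemma first_equation_iff:
  "(\<forall>a b c. module_prod.scale sL sV 2 (nr_bracket twist D R a b c) + nr_bracket twist R R a b c
            + module_prod.scale sL sV 2 (nr_bracket twist U T a b c) = 0) \<longleftrightarrow>
   (\<forall>x y v. defect_LLV x y v = 0 \<and> defect_LVL x v y = 0 \<and> defect_VLL v x y = 0)"
proof -
  let ?X = "\<lambda>a b c. nr_bracket twist D R a b c + circ_l twist R R a b c + nr_bracket twist U T a b c"
  have "module_prod.scale sL sV 2 (nr_bracket twist D R a b c) + nr_bracket twist R R a b c
            + module_prod.scale sL sV 2 (nr_bracket twist U T a b c) = ?X a b c + ?X a b c" for a b c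
    unfolding scale_two nr_bracket_def[of _ R R] plus_fun_apply by (simp only: ac_simps)
  then show ?thesis
    unfolding first_equation_split[symmetric]
    by (simp only: split_paired_All half_first_equation) (auto simp: zero_prod_def double_eq_zero_iff)
qed

lemma second_equation_iff:
  "nr_bracket twist U R = 0 \<longleftrightarrow>
   (\<forall>x v w. defect_LVV x v w = 0 \<and> defect_VLV v x w = 0 \<and> defect_VVL v w x = 0)"
  unfolding second_equation_split[symmetric]
  by (simp only: fun_eq_iff split_paired_All bracket_product_action) (auto simp: zero_prod_def)

lemma third_equation_iff:
  "nr_bracket twist (D + R) T = 0 \<longleftrightarrow>
   (\<forall>x y z. \<theta> (\<delta> x y) (\<alpha> z) + \<theta> (\<alpha> y) (\<delta> x z) - \<theta> (\<alpha> x) (\<delta> y z)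
        + lam_r (\<theta> x y) (\<alpha> z) + lam_l (\<alpha> y) (\<theta> x z) - lam_l (\<alpha> x) (\<theta> y z) = 0)"
  by (simp only: fun_eq_iff split_paired_All bracket_cochain) (auto simp: zero_prod_def)

end

theorem proposition5p1:
  fixes sL :: "'k::field_char_0 \<Rightarrow> 'l::ab_group_add \<Rightarrow> 'l"
    and \<delta> :: "'l \<Rightarrow> 'l \<Rightarrow> 'l"
    and \<alpha> :: "'l \<Rightarrow> 'l"
    and sV :: "'k \<Rightarrow> 'v::ab_group_add \<Rightarrow> 'v"
    and \<mu> :: "'v \<Rightarrow> 'v \<Rightarrow> 'v"
    and \<alpha>V :: "'v \<Rightarrow> 'v"
    and lam_l :: "'l \<Rightarrow> 'v \<Rightarrow> 'v"
    and lam_r :: "'v \<Rightarrow> 'l \<Rightarrow> 'v"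
    and \<theta> :: "'l \<Rightarrow> 'l \<Rightarrow> 'v"
  assumes L: "left_hom_leibniz sL \<delta> \<alpha>"
    and V: "left_hom_leibniz sV \<mu> \<alpha>V"
    and "bilinear_map sL sV sV lam_l"
    and "bilinear_map sV sL sV lam_r"
    and "bilinear_map sL sL sV \<theta>"
  shows "is_2cocycle sL \<delta> \<alpha> sV \<mu> \<alpha>V lam_r lam_l \<theta> \<longleftrightarrow>
    (\<forall>x y z v w.
      lam_r (\<alpha>V v) (\<alpha> x) = \<alpha>V (lam_r v x) \<and>
      lam_l (\<alpha> x) (\<alpha>V v) = \<alpha>V (lam_l x v) \<and>
      lam_l (\<alpha> x) (lam_l y v) =
        lam_l (\<delta> x y) (\<alpha>V v) + lam_l (\<alpha> y) (lam_l x v) + \<mu> (\<theta> x y) (\<alpha>V v) \<and>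
      lam_l (\<alpha> x) (lam_r v y) =
        lam_r (lam_l x v) (\<alpha> y) + lam_r (\<alpha>V v) (\<delta> x y) + \<mu> (\<alpha>V v) (\<theta> x y) \<and>
      lam_r (\<alpha>V v) (\<delta> x y) =
        lam_r (lam_r v x) (\<alpha> y) + lam_l (\<alpha> x) (lam_r v y) - \<mu> (\<alpha>V v) (\<theta> x y) \<and>
      lam_l (\<alpha> x) (\<mu> v w) = \<mu> (\<alpha>V v) (lam_l x w) + \<mu> (lam_l x v) (\<alpha>V w) \<and>
      \<mu> (\<alpha>V v) (lam_l x w) = \<mu> (lam_r v x) (\<alpha>V w) + lam_l (\<alpha> x) (\<mu> v w) \<and>
      \<mu> (\<alpha>V v) (lam_r w x) = \<mu> (\<alpha>V w) (lam_r v x) + lam_r (\<mu> v w) (\<alpha> x) \<and>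
      \<theta> (\<alpha> x) (\<alpha> y) = \<alpha>V (\<theta> x y) \<and>
      \<theta> (\<delta> x y) (\<alpha> z) + \<theta> (\<alpha> y) (\<delta> x z) - \<theta> (\<alpha> x) (\<delta> y z)
        + lam_r (\<theta> x y) (\<alpha> z) + lam_l (\<alpha> y) (\<theta> x z) - lam_l (\<alpha> x) (\<theta> y z) = 0)"
proof -
  interpret L: left_hom_leibniz sL \<delta> \<alpha> by (rule L)
  interpret V: left_hom_leibniz sV \<mu> \<alpha>V by (rule V)
  interpret extension_data sL \<delta> \<alpha> sV \<mu> \<alpha>V lam_l lam_r \<theta>
    by unfold_locales (fact assms)+
  show ?thesis
    unfolding is_2cocycle_def Let_def first_equation_iff second_equation_iff third_equation_iff
      defect_defs right_minus_eq
    by (intro iffI; (elim conjE)?; intro allI conjI; metis)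
qed

end
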